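(* Let $(X,d)$ be an infinite metric space and let $\mathfrak{B}$ be a bornology on $X$ with a compact base such that $X\notin\mathfrak{B}$. The following statements are equivalent. (1) $\mathfrak{B}$ has a countable base. (2) ONE has a predetermined winning strategy in the Gruenhage game $\mathsf{G}(\tau^s_{\mathfrak{B}})$. (3) ONE has a predetermined winning strategy in $\mathsf{CL}(\tau^s_{\mathfrak{B}})$. (4) ONE has a predetermined winning strategy in $\mathsf{CD}(\tau^s_{\mathfrak{B}})$. (5) ONE has a predetermined winning strategy in $\mathcal{O}_{\mathfrak{B}^s}(X)$.
   Context: A bornology on a set $X$ is a family $\mathfrak{B}$ of subsets of $X$ that covers $X$, is closed under finite unions and is closed under taking subsets. A base of $\mathfrak{B}$ is a subfamily $\mathfrak{B}_0\subseteq\mathfrak{B}$ such that every $B\in\mathfrak{B}$ is contained in some $B_0\in\mathfrak{B}_0$; it is a compact base if all its members are compact. For $B\subseteq X$ and $\delta>0$, $B^\delta=\bigcup_{x\in B}\{y\in X: d(x,y)<\delta\}$. $C(X)$ is the set of continuous functions $X\to\mathbb{R}$, and $\underline{0}$ is the zero function. The topology $\tau^s_{\mathfrak{B}}$ of strong uniform convergence on $\mathfrak{B}$ is the topology on $C(X)$ induced by the uniformity with base consisting of the sets $[B,\varepsilon]^s=\{(f,g): \exists\delta>0\ \forall x\in B^\delta,\ |f(x)-g(x)|<\varepsilon\}$, $B\in\mathfrak{B}$, $\varepsilon>0$. Games are played by ONE and TWO in rounds $n\in\mathbb{N}$. A predetermined strategy for ONE is one that depends only on the round number $n$; it is winning if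 ONE, following it, wins whatever TWO plays. - $\mathsf{G}(\tau^s_{\mathfrak{B}})$: in round $n$ ONE chooses an open neighbourhood $W_n$ of $\underline{0}$ in $(C(X),\tau^s_{\mathfrak{B}})$ and TWO chooses $f_n\in W_n$. ONE wins if $(f_n)$ converges to $\underline{0}$ in $(C(X),\tau^s_{\mathfrak{B}})$; otherwise TWO wins. - $\mathsf{CL}(\tau^s_{\mathfrak{B}})$: in round $n$ ONE chooses a nonempty open subset $W_n$ of $(C(X),\tau^s_{\mathfrak{B}})$ and TWO chooses $f_n\in W_n$. ONE wins if $\underline{0}\in\overline{\{f_n:n\in\mathbb{N}\}}$; otherwise TWO wins. - $\mathsf{CD}(\tau^s_{\mathfrak{B}})$: in round $n$ ONE chooses a nonempty open subset $W_n$ of $(C(X),\tau^s_{\mathfrak{B}})$ and TWO chooses $f_n\in W_n$. TWO wins if the set $\{f_n:n\in\mathbb{N}\}$ is closed and discrete; otherwise ONE wins. - $\mathcal{O}_{\mathfrak{B}^s}(X)$: in round $n$ ONE chooses $B_n\in\mathfrak{B}$ and TWO chooses an open set $U_n\subseteq X$, $U_n\ne X$, such that $B_n^{\delta_n}\subseteq U_n$ for some $\delta_n>0$. ONE wins if $\{U_n:n\in\mathbb{N}\}$ is an open $\mathfrak{B}^s$-cover of $X$, i.e. it covers $X$, does not contain $X$ as a member, and for every $B\in\mathfrak{B}$ there are $n$ and $\delta>0$ with $B^\delta\subseteq U_n$; otherwise TWO wins. *)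

theory Defs
  imports "HOL-Analysis.Analysis"
begin

definition bornology :: "'a set set \<Rightarrow> bool" where
  "bornology \<BB> \<longleftrightarrow>
     \<Union>\<BB> = UNIV \<and>
     (\<forall>\<F>. finite \<F> \<and> \<F> \<subseteq> \<BB> \<longrightarrow> \<Union>\<F> \<in> \<BB>) \<and>
     (\<forall>B\<in>\<BB>. \<forall>A. A \<subseteq> B \<longrightarrow> A \<in> \<BB>)"

definition bornology_base :: "'a set set \<Rightarrow> 'a set set \<Rightarrow> bool" where
  "bornology_base \<BB> \<BB>\<^sub>0 \<longleftrightarrow> \<BB>\<^sub>0 \<subseteq> \<BB> \<and> (\<forall>B\<in>\<BB>. \<exists>B\<^sub>0\<in>\<BB>\<^sub>0. B \<subseteq> B\<^sub>0)"

definition has_compact_base :: "'a::topological_space set set \<Rightarrow> bool" where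
  "has_compact_base \<BB> \<longleftrightarrow> (\<exists>\<BB>\<^sub>0. bornology_base \<BB> \<BB>\<^sub>0 \<and> (\<forall>B\<in>\<BB>\<^sub>0. compact B))"

definition has_countable_base :: "'a set set \<Rightarrow> bool" where
  "has_countable_base \<BB> \<longleftrightarrow> (\<exists>\<BB>\<^sub>0. bornology_base \<BB> \<BB>\<^sub>0 \<and> countable \<BB>\<^sub>0)"

definition enlargement :: "'a::metric_space set \<Rightarrow> real \<Rightarrow> 'a set" where
  "enlargement B \<delta> = (\<Union>x\<in>B. {y. dist x y < \<delta>})"


definition cont_funs :: "('a::topological_space \<Rightarrow> real) set" where
  "cont_funs = {f. continuous_on UNIV f}"

definition strong_entourage ::
    "'a::metric_space set \<Rightarrow> real \<Rightarrow> (('a \<Rightarrow> real) \<times> ('a \<Rightarrow> real)) set" where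
  "strong_entourage B \<epsilon> =
     {(f, g). f \<in> cont_funs \<and> g \<in> cont_funs \<and>
        (\<exists>\<delta>>0. \<forall>x\<in>enlargement B \<delta>. \<bar>f x - g x\<bar> < \<epsilon>)}"

definition strong_uniformity ::
    "'a::metric_space set set \<Rightarrow> (('a \<Rightarrow> real) \<times> ('a \<Rightarrow> real)) set set" where
  "strong_uniformity \<BB> =
     {E. E \<subseteq> cont_funs \<times> cont_funs \<and> (\<exists>B\<in>\<BB>. \<exists>\<epsilon>>0. strong_entourage B \<epsilon> \<subseteq> E)}"

text \<open>The library's uniform spaces are type classes, so the topology that a uniformity induces
  on the carrier \<^const>\<open>cont_funs\<close> is spelled out. The argument of \<^const>\<open>topology\<close> satisfies
  \<^const>\<open>istopology\<close> whenever \<open>\<BB>\<close> is a bornology, see \<open>openin_strong_topology\<close>.\<close>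

definition strong_topology :: "'a::metric_space set set \<Rightarrow> ('a \<Rightarrow> real) topology" where
  "strong_topology \<BB> =
     topology (\<lambda>W. W \<subseteq> cont_funs \<and> (\<forall>f\<in>W. \<exists>E\<in>strong_uniformity \<BB>. E `` {f} \<subseteq> W))"

lemma enlargement_mono: "A \<subseteq> B \<Longrightarrow> \<delta> \<le> \<delta>' \<Longrightarrow> enlargement A \<delta> \<subseteq> enlargement B \<delta>'"
  unfolding enlargement_def by fastforce

lemma strong_entourage_mono:
  assumes "A \<subseteq> B" "\<epsilon> \<le> \<epsilon>'"
  shows "strong_entourage B \<epsilon> \<subseteq> strong_entourage A \<epsilon>'"
  using enlargement_mono[OF assms(1) order_refl] assms(2)
  unfolding strong_entourage_def by fastforce

lemma strong_uniformity_Int: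
  assumes "bornology \<BB>" "E \<in> strong_uniformity \<BB>" "F \<in> strong_uniformity \<BB>"
  shows "E \<inter> F \<in> strong_uniformity \<BB>"
proof -
  obtain A a where A: "A \<in> \<BB>" "a > 0" "strong_entourage A a \<subseteq> E"
    using assms(2) unfolding strong_uniformity_def by blast
  obtain B b where B: "B \<in> \<BB>" "b > 0" "strong_entourage B b \<subseteq> F"
    using assms(3) unfolding strong_uniformity_def by blast
  have "\<And>\<F>. finite \<F> \<Longrightarrow> \<F> \<subseteq> \<BB> \<Longrightarrow> \<Union>\<F> \<in> \<BB>"
    using assms(1) unfolding bornology_def by simp
  from this[of "{A, B}"] have "A \<union> B \<in> \<BB>"
    using A(1) B(1) by simp
  moreover have "strong_entourage (A \<union> B) (min a b) \<subseteq> E \<inter> F"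
    using strong_entourage_mono[of A "A \<union> B" "min a b" a]
      strong_entourage_mono[of B "A \<union> B" "min a b" b] A(3) B(3) by auto
  moreover have "E \<inter> F \<subseteq> cont_funs \<times> cont_funs"
    using assms(2) unfolding strong_uniformity_def by blast
  moreover have "min a b > 0"
    using A(2) B(2) by simp
  ultimately show ?thesis
    unfolding strong_uniformity_def mem_Collect_eq
    by (intro conjI bexI[of _ "A \<union> B"] exI[of _ "min a b"])
qed

lemma openin_strong_topology:
  assumes "bornology \<BB>"
  shows "openin (strong_topology \<BB>) W \<longleftrightarrow>
    W \<subseteq> cont_funs \<and> (\<forall>f\<in>W. \<exists>E\<in>strong_uniformity \<BB>. E `` {f} \<subseteq> W)"
proof -
  let ?O = "\<lambda>W. W \<subseteq> cont_funs \<and> (\<forall>f\<in>W. \<exists>E\<in>strong_uniformity \<BB>. E `` {f} \<subseteq> W)"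
  have "?O (S \<inter> T)" if S: "?O S" and T: "?O T" for S T
  proof (intro conjI ballI)
    show "S \<inter> T \<subseteq> cont_funs" using S by blast
    fix f assume f: "f \<in> S \<inter> T"
    obtain E where E: "E \<in> strong_uniformity \<BB>" "E `` {f} \<subseteq> S"
      using S f by blast
    obtain F where F: "F \<in> strong_uniformity \<BB>" "F `` {f} \<subseteq> T"
      using T f by blast
    have "(E \<inter> F) `` {f} \<subseteq> S \<inter> T"
      using E(2) F(2) by blast
    then show "\<exists>E\<in>strong_uniformity \<BB>. E `` {f} \<subseteq> S \<inter> T"
      using strong_uniformity_Int[OF assms E(1) F(1)] by (rule bexI)
  qed
  moreover have "?O (\<Union>\<K>)" if K: "\<forall>W\<in>\<K>. ?O W" for \<K>
  proof (intro conjI ballI)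
    show "\<Union>\<K> \<subseteq> cont_funs" using K by (intro Union_least) simp
    fix f assume "f \<in> \<Union>\<K>"
    then obtain W where W: "W \<in> \<K>" "f \<in> W" by (rule UnionE)
    then obtain E where "E \<in> strong_uniformity \<BB>" "E `` {f} \<subseteq> W"
      using K by blast
    moreover have "W \<subseteq> \<Union>\<K>" using W(1) by (rule Union_upper)
    ultimately show "\<exists>E\<in>strong_uniformity \<BB>. E `` {f} \<subseteq> \<Union>\<K>"
      by (meson order_trans)
  qed
  ultimately have "istopology ?O"
    unfolding istopology_def by presburger
  then show ?thesis
    unfolding strong_topology_def by (subst topology_inverse') (assumption, rule refl)
qed

lemma topspace_strong_topology:
  assumes "bornology \<BB>"
  shows "topspace (strong_topology \<BB>) = cont_funs"
proof -
  have "\<Union>\<BB> = UNIV"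
    using assms unfolding bornology_def by simp
  then obtain B where B: "B \<in> \<BB>"
    by (metis UNIV_I UnionE)
  have "strong_entourage B 1 \<subseteq> cont_funs \<times> cont_funs"
    unfolding strong_entourage_def by blast
  then have "cont_funs \<times> cont_funs \<in> strong_uniformity \<BB>"
    unfolding strong_uniformity_def mem_Collect_eq
    using B by (intro conjI subset_refl bexI[of _ B] exI[of _ 1] zero_less_one)
  then have "openin (strong_topology \<BB>) cont_funs"
    unfolding openin_strong_topology[OF assms]
    by (intro conjI ballI subset_refl bexI[of _ "cont_funs \<times> cont_funs"]) auto
  then have "cont_funs \<subseteq> topspace (strong_topology \<BB>)"
    by (rule openin_subset)
  moreover have "topspace (strong_topology \<BB>) \<subseteq> cont_funs"
    using openin_topspace[of "strong_topology \<BB>"]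
    unfolding openin_strong_topology[OF assms] by (rule conjunct1)
  ultimately show ?thesis by blast
qed


text \<open>In every game considered the outcome depends only on the sequence of TWO's moves, so this
  sequence alone is the argument of the winning condition. In each round, TWO's legal replies
  depend only on ONE's move in that round.\<close>

record ('m, 'r) game =
  ONE_moves :: "'m set"
  TWO_replies :: "'m \<Rightarrow> 'r set"
  ONE_wins :: "(nat \<Rightarrow> 'r) \<Rightarrow> bool"

definition predetermined_winning :: "('m, 'r) game \<Rightarrow> (nat \<Rightarrow> 'm) \<Rightarrow> bool" where
  "predetermined_winning G \<sigma> \<longleftrightarrow>
     (\<forall>n. \<sigma> n \<in> ONE_moves G) \<and>
     (\<forall>r. (\<forall>n. r n \<in> TWO_replies G (\<sigma> n)) \<longrightarrow> ONE_wins G r)"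

definition ONE_has_predetermined_winning_strategy :: "('m, 'r) game \<Rightarrow> bool" where
  "ONE_has_predetermined_winning_strategy G \<longleftrightarrow> (\<exists>\<sigma>. predetermined_winning G \<sigma>)"

definition Gruenhage_game ::
    "'a::metric_space set set \<Rightarrow> (('a \<Rightarrow> real) set, 'a \<Rightarrow> real) game" where
  "Gruenhage_game \<BB> =
     \<lparr>ONE_moves = {W. openin (strong_topology \<BB>) W \<and> (\<lambda>x. 0) \<in> W},
      TWO_replies = (\<lambda>W. W),
      ONE_wins = (\<lambda>f. limitin (strong_topology \<BB>) f (\<lambda>x. 0) sequentially)\<rparr>"

definition CL_game ::
    "'a::metric_space set set \<Rightarrow> (('a \<Rightarrow> real) set, 'a \<Rightarrow> real) game" where
  "CL_game \<BB> =
     \<lparr>ONE_moves = {W. openin (strong_topology \<BB>) W \<and> W \<noteq> {}},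
      TWO_replies = (\<lambda>W. W),
      ONE_wins = (\<lambda>f. (\<lambda>x. 0) \<in> strong_topology \<BB> closure_of range f)\<rparr>"

definition closed_discrete_in :: "'a topology \<Rightarrow> 'a set \<Rightarrow> bool" where
  "closed_discrete_in T S \<longleftrightarrow> closedin T S \<and> subtopology T S = discrete_topology S"

definition CD_game ::
    "'a::metric_space set set \<Rightarrow> (('a \<Rightarrow> real) set, 'a \<Rightarrow> real) game" where
  "CD_game \<BB> =
     \<lparr>ONE_moves = {W. openin (strong_topology \<BB>) W \<and> W \<noteq> {}},
      TWO_replies = (\<lambda>W. W),
      ONE_wins = (\<lambda>f. \<not> closed_discrete_in (strong_topology \<BB>) (range f))\<rparr>"

definition open_strong_cover :: "'a::metric_space set set \<Rightarrow> 'a set set \<Rightarrow> bool" where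
  "open_strong_cover \<BB> \<U> \<longleftrightarrow>
     (\<forall>U\<in>\<U>. open U) \<and> \<Union>\<U> = UNIV \<and> UNIV \<notin> \<U> \<and>
     (\<forall>B\<in>\<BB>. \<exists>U\<in>\<U>. \<exists>\<delta>>0. enlargement B \<delta> \<subseteq> U)"

definition open_cover_game :: "'a::metric_space set set \<Rightarrow> ('a set, 'a set) game" where
  "open_cover_game \<BB> =
     \<lparr>ONE_moves = \<BB>,
      TWO_replies = (\<lambda>B. {U. open U \<and> U \<noteq> UNIV \<and> (\<exists>\<delta>>0. enlargement B \<delta> \<subseteq> U)}),
      ONE_wins = (\<lambda>U. open_strong_cover \<BB> (range U))\<rparr>"

end

theory Submission
  imports Defs
begin

text \<open>Suppose \<open>B\<^sub>0, B\<^sub>1, \<dots>\<close> are members of \<open>\<BB>\<close> and \<open>\<BB>\<close> has no countable base. Since the closures of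
  the \<open>B\<^sub>n\<close> belong to \<open>\<BB>\<close> as well, they do not form a base, so some compact \<open>B \<in> \<BB>\<close> contains for
  each \<open>n\<close> a point \<open>x\<^sub>n\<close> outside the closure of \<open>B\<^sub>n\<close>. This defeats every predetermined strategy: in the
  covering game TWO plays the complement of \<open>x\<^sub>n\<close>; in the function space games TWO modifies a function
  of ONE's open set by a bump at \<open>x\<^sub>n\<close>, far from the \<open>B\<^sub>n\<close> that controls this open set, to obtain
  a prescribed value at \<open>x\<^sub>n\<close>. The value 1 keeps the functions away from 0 on \<open>B\<close>; the values \<open>n\<close>
  make them locally finite, because continuous functions are bounded on \<open>B\<close>. Conversely, a countable
  base yields a decreasing neighbourhood base at 0, which ONE plays; in \<open>CD\<close> ONE removes 0 itself,
  so that TWO's functions converge to a point outside their range.\<close>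

section \<open>Bornologies with a compact base\<close>

lemma bornology_Union: "bornology \<BB> \<Longrightarrow> finite \<F> \<Longrightarrow> \<F> \<subseteq> \<BB> \<Longrightarrow> \<Union>\<F> \<in> \<BB>"
  unfolding bornology_def by blast

lemma bornology_subset: "bornology \<BB> \<Longrightarrow> B \<in> \<BB> \<Longrightarrow> A \<subseteq> B \<Longrightarrow> A \<in> \<BB>"
  unfolding bornology_def by blast

lemma bornology_singleton:
  assumes "bornology \<BB>"
  shows "{x} \<in> \<BB>"
proof -
  obtain B where "B \<in> \<BB>" "x \<in> B"
    using assms unfolding bornology_def by blast
  then show ?thesis
    using bornology_subset[OF assms, of B "{x}"] by blast
qed

lemma compact_hull_in_bornology:
  assumes "has_compact_base \<BB>" "B \<in> \<BB>"
  obtains K where "K \<in> \<BB>" "compact K" "B \<subseteq> K"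
  using assms unfolding has_compact_base_def bornology_base_def by blast

text \<open>Compactness of the base enters here: a compact hull of \<open>B\<close> is closed, so it
  also contains the closure of \<open>B\<close>.\<close>

lemma closure_in_bornology:
  fixes \<BB> :: "'a::metric_space set set"
  assumes "bornology \<BB>" "has_compact_base \<BB>" "B \<in> \<BB>"
  shows "closure B \<in> \<BB>"
proof -
  obtain K where K: "K \<in> \<BB>" "compact K" "B \<subseteq> K"
    using compact_hull_in_bornology[OF assms(2,3)] .
  then have "closure B \<subseteq> K"
    by (simp add: closure_minimal compact_imp_closed)
  then show ?thesis
    using bornology_subset[OF assms(1) K(1)] by blast
qed

lemma points_escaping_sequence:
  fixes \<BB> :: "'a::metric_space set set"
  assumes "bornology \<BB>" "has_compact_base \<BB>" "\<not> has_countable_base \<BB>" "\<And>n::nat. B n \<in> \<BB>"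
  obtains K x where "K \<in> \<BB>" "compact K" "\<And>n. x n \<in> K" "\<And>n. x n \<notin> closure (B n)"
proof -
  have "\<not> bornology_base \<BB> (range (\<lambda>n. closure (B n)))"
    using assms(3) unfolding has_countable_base_def by blast
  moreover have "range (\<lambda>n. closure (B n)) \<subseteq> \<BB>"
    using closure_in_bornology[OF assms(1,2,4)] by blast
  ultimately have "\<exists>A\<in>\<BB>. \<forall>n. \<not> A \<subseteq> closure (B n)"
    unfolding bornology_base_def by auto
  then obtain A where A: "A \<in> \<BB>" "\<And>n. \<not> A \<subseteq> closure (B n)"
    by metis
  obtain K where K: "K \<in> \<BB>" "compact K" "A \<subseteq> K"
    using compact_hull_in_bornology[OF assms(2) A(1)] .
  have "\<forall>n. \<exists>y. y \<in> K \<and> y \<notin> closure (B n)"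
    using A(2) K(3) by blast
  then show ?thesis
    using that K(1,2) by metis
qed

text \<open>Along an enumeration of a countable base, the unions of initial segments increase and
  stay in the bornology, being finite unions.\<close>

lemma countable_base_increasing:
  assumes "bornology \<BB>" "has_countable_base \<BB>"
  obtains C :: "nat \<Rightarrow> 'a set" where "\<And>n. C n \<in> \<BB>" "incseq C" "\<And>B. B \<in> \<BB> \<Longrightarrow> \<exists>n. B \<subseteq> C n"
proof -
  obtain \<BB>\<^sub>0 where \<BB>\<^sub>0: "bornology_base \<BB> \<BB>\<^sub>0" "countable \<BB>\<^sub>0"
    using assms(2) unfolding has_countable_base_def by blast
  \<comment> \<open>The empty set must lie in some member of the base, so the base is nonempty and
    \<open>from_nat_into\<close> enumerates exactly its members.\<close>
  have "{} \<in> \<BB>"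
    using bornology_Union[OF assms(1), of "{}"] by simp
  then have "\<BB>\<^sub>0 \<noteq> {}"
    using \<BB>\<^sub>0(1) unfolding bornology_base_def by blast
  then have range: "range (from_nat_into \<BB>\<^sub>0) = \<BB>\<^sub>0"
    using \<BB>\<^sub>0(2) by (rule range_from_nat_into)
  define C where "C n = \<Union> (from_nat_into \<BB>\<^sub>0 ` {..n})" for n
  show ?thesis
  proof
    show "C n \<in> \<BB>" for n
      unfolding C_def using range \<BB>\<^sub>0(1)
      by (intro bornology_Union[OF assms(1)]) (auto simp: bornology_base_def)
    show "incseq C"
      unfolding C_def incseq_def by fastforce
    fix B assume "B \<in> \<BB>"
    then obtain n where "B \<subseteq> from_nat_into \<BB>\<^sub>0 n"
      using \<BB>\<^sub>0(1) range unfolding bornology_base_def by (metis rangeE)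
    then show "\<exists>n. B \<subseteq> C n"
      unfolding C_def by blast
  qed
qed

section \<open>Bump functions vanishing near a set\<close>

lemma subset_enlargement: "0 < \<delta> \<Longrightarrow> B \<subseteq> enlargement B \<delta>"
  unfolding enlargement_def by fastforce

text \<open>A point \<open>x\<close> off the closure of \<open>B\<close> keeps a distance of at
  least \<open>2 * r\<close> from \<open>B\<close>. Half of it is spent on the enlargement of
  \<open>B\<close>, the other half on the support of the cone of radius \<open>r\<close> around
  \<open>x\<close>.\<close>

lemma bump_off_closure:
  fixes x :: "'a::metric_space"
  assumes "x \<notin> closure B"
  obtains \<phi> :: "'a \<Rightarrow> real" and \<delta>
  where "continuous_on UNIV \<phi>" "\<phi> x = 1" "0 < \<delta>" "\<And>y. y \<in> enlargement B \<delta> \<Longrightarrow> \<phi> y = 0"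
proof -
  obtain r where r: "0 < r" "\<And>b. b \<in> B \<Longrightarrow> 2 * r \<le> dist b x"
  proof -
    obtain e where "0 < e" "\<forall>b\<in>B. e \<le> dist b x"
      using assms unfolding closure_approachable by (meson not_less)
    then show ?thesis
      using that[of "e / 2"] by auto
  qed
  show ?thesis
  proof
    show "continuous_on UNIV (\<lambda>y. max 0 (1 - dist x y / r))"
      using r(1) by (intro continuous_intros) auto
    show "0 < r" by (fact r(1))
    fix y assume "y \<in> enlargement B r"
    then obtain b where "b \<in> B" "dist b y < r"
      unfolding enlargement_def by blast
    then have "r \<le> dist x y"
      using r(2)[of b] dist_triangle[of b x y] by (simp add: dist_commute)
    then show "max 0 (1 - dist x y / r) = 0"
      using r(1) by (simp add: field_simps)
  qed simp
qed

section \<open>Open neighbourhoods and separation in the strong topology\<close>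

text \<open>The slack between \<open>e\<close> and \<open>\<epsilon>\<close> is what makes these sets open.\<close>

definition strong_nbhd :: "('a::metric_space \<Rightarrow> real) \<Rightarrow> 'a set \<Rightarrow> real \<Rightarrow> ('a \<Rightarrow> real) set" where
  "strong_nbhd f B \<epsilon> =
     {g \<in> cont_funs. \<exists>e<\<epsilon>. \<exists>\<delta>>0. \<forall>x\<in>enlargement B \<delta>. \<bar>g x - f x\<bar> < e}"

lemma strong_nbhd_self: "f \<in> cont_funs \<Longrightarrow> 0 < \<epsilon> \<Longrightarrow> f \<in> strong_nbhd f B \<epsilon>"
  unfolding strong_nbhd_def mem_Collect_eq
  by (intro conjI exI[of _ "\<epsilon> / 2"] exI[of _ 1]) auto

lemma strong_nbhd_less:
  assumes "g \<in> strong_nbhd f B \<epsilon>" "x \<in> B"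
  shows "\<bar>g x - f x\<bar> < \<epsilon>"
proof -
  obtain e \<delta> where "e < \<epsilon>" "0 < \<delta>" "\<forall>x\<in>enlargement B \<delta>. \<bar>g x - f x\<bar> < e"
    using assms(1) unfolding strong_nbhd_def by blast
  then show ?thesis
    using assms(2) subset_enlargement[of \<delta> B] by force
qed

text \<open>Together with \<open>openin_strong_nbhd\<close> this gives open neighbourhood bases. The
  freedom in \<open>A\<close> and \<open>\<epsilon>'\<close> lets the late terms of a shrinking
  sequence of neighbourhoods fit into a fixed entourage.\<close>

lemma strong_nbhd_subset_entourage:
  assumes "f \<in> cont_funs" "A \<subseteq> B" "\<epsilon> \<le> \<epsilon>'"
  shows "strong_nbhd f B \<epsilon> \<subseteq> strong_entourage A \<epsilon>' `` {f}"
proof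
  fix g assume "g \<in> strong_nbhd f B \<epsilon>"
  then obtain e \<delta> where g: "g \<in> cont_funs" "e < \<epsilon>" "0 < \<delta>"
      "\<forall>x\<in>enlargement B \<delta>. \<bar>g x - f x\<bar> < e"
    unfolding strong_nbhd_def by blast
  have "\<forall>x\<in>enlargement A \<delta>. \<bar>f x - g x\<bar> < \<epsilon>'"
    using g(2,4) enlargement_mono[OF assms(2) order_refl, of \<delta>] assms(3) by fastforce
  then show "g \<in> strong_entourage A \<epsilon>' `` {f}"
    using assms(1) g(1,3) unfolding strong_entourage_def by blast
qed

lemma openin_strong_nbhd:
  assumes "bornology \<BB>" "B \<in> \<BB>"
  shows "openin (strong_topology \<BB>) (strong_nbhd f B \<epsilon>)"
  unfolding openin_strong_topology[OF assms(1)]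
proof (intro conjI ballI)
  show "strong_nbhd f B \<epsilon> \<subseteq> cont_funs"
    unfolding strong_nbhd_def by blast
  fix g assume "g \<in> strong_nbhd f B \<epsilon>"
  then obtain e \<delta> where g: "g \<in> cont_funs" "e < \<epsilon>" "0 < \<delta>"
      "\<forall>x\<in>enlargement B \<delta>. \<bar>g x - f x\<bar> < e"
    unfolding strong_nbhd_def by blast
  \<comment> \<open>Half of the slack at \<open>g\<close> is given away: the functions reached from
    \<open>g\<close> obey the bound \<open>(\<epsilon> + e) / 2\<close>, which is still strictly
    below \<open>\<epsilon>\<close>.\<close>
  let ?E = "strong_entourage B ((\<epsilon> - e) / 2)"
  have "?E \<in> strong_uniformity \<BB>"
    unfolding strong_uniformity_def mem_Collect_eq
  proof (intro conjI bexI[OF _ assms(2)] exI[of _ "(\<epsilon> - e) / 2"] order_refl)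
    show "?E \<subseteq> cont_funs \<times> cont_funs"
      unfolding strong_entourage_def by blast
  qed (use g(2) in simp)
  moreover have "?E `` {g} \<subseteq> strong_nbhd f B \<epsilon>"
  proof
    fix h assume "h \<in> ?E `` {g}"
    then obtain \<eta> where h: "h \<in> cont_funs" "0 < \<eta>" "\<forall>x\<in>enlargement B \<eta>. \<bar>g x - h x\<bar> < (\<epsilon> - e) / 2"
      unfolding strong_entourage_def by blast
    have "\<bar>h x - f x\<bar> < (\<epsilon> + e) / 2" if "x \<in> enlargement B (min \<delta> \<eta>)" for x
    proof -
      have "x \<in> enlargement B \<delta>" "x \<in> enlargement B \<eta>"
        using that enlargement_mono[OF order_refl] by (meson min.cobounded1 min.cobounded2 subsetD)+
      then have "\<bar>g x - f x\<bar> < e" "\<bar>g x - h x\<bar> < (\<epsilon> - e) / 2"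
        using g(4) h(3) by auto
      then show ?thesis
        using abs_triangle_ineq4[of "g x - f x" "g x - h x"] by (simp add: field_simps)
    qed
    moreover have "(\<epsilon> + e) / 2 < \<epsilon>" "0 < min \<delta> \<eta>"
      using g(2,3) h(2) by auto
    ultimately show "h \<in> strong_nbhd f B \<epsilon>"
      using h(1) unfolding strong_nbhd_def by blast
  qed
  ultimately show "\<exists>E\<in>strong_uniformity \<BB>. E `` {g} \<subseteq> strong_nbhd f B \<epsilon>" ..
qed

lemma openin_strong_topologyE:
  assumes "bornology \<BB>" "openin (strong_topology \<BB>) W" "f \<in> W"
  obtains B \<epsilon> where "B \<in> \<BB>" "0 < \<epsilon>" "strong_entourage B \<epsilon> `` {f} \<subseteq> W"
proof -
  obtain E where "E \<in> strong_uniformity \<BB>" "E `` {f} \<subseteq> W"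
    using assms openin_strong_topology by blast
  then show ?thesis
    using that unfolding strong_uniformity_def by blast
qed

text \<open>Singletons belong to the bornology, so functions are separated by their values at one
  point. This makes finite sets closed and lets ONE delete the zero function from an open
  set.\<close>

lemma t1_space_strong_topology:
  assumes "bornology \<BB>"
  shows "t1_space (strong_topology \<BB>)"
  unfolding t1_space_def topspace_strong_topology[OF assms]
proof (intro ballI impI)
  fix f g :: "'a \<Rightarrow> real"
  assume fg: "f \<in> cont_funs" "g \<in> cont_funs" "f \<noteq> g"
  then obtain x where x: "f x \<noteq> g x" by blast
  let ?U = "strong_nbhd f {x} \<bar>g x - f x\<bar>"
  have "openin (strong_topology \<BB>) ?U"
    using openin_strong_nbhd[OF assms bornology_singleton[OF assms]] .
  moreover have "f \<in> ?U"
    using x by (intro strong_nbhd_self fg(1)) simp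
  moreover have "g \<notin> ?U"
    using strong_nbhd_less[of g f "{x}" _ x] by blast
  ultimately show "\<exists>U. openin (strong_topology \<BB>) U \<and> f \<in> U \<and> g \<notin> U" by blast
qed

section \<open>TWO's replies with prescribed values\<close>

text \<open>A multiple of a bump that vanishes on an enlargement of \<open>B\<close> changes a
  function of \<open>W\<close> nowhere near \<open>B\<close>, so the result stays in
  \<open>W\<close> however large the multiple is. The set \<open>B\<close> is fixed before
  \<open>x\<close> and \<open>c\<close>, so that TWO can choose the points against all these sets at
  once.\<close>

lemma open_set_attains_value_off_closure:
  assumes "bornology \<BB>" "openin (strong_topology \<BB>) W" "W \<noteq> {}"
  obtains B where "B \<in> \<BB>" "\<And>x c. x \<notin> closure B \<Longrightarrow> \<exists>f\<in>W. f x = c"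
proof -
  obtain g where g: "g \<in> W" using assms(3) by blast
  then have "g \<in> cont_funs"
    using assms(1,2) openin_strong_topology by blast
  obtain B \<epsilon> where B: "B \<in> \<BB>" "0 < \<epsilon>" "strong_entourage B \<epsilon> `` {g} \<subseteq> W"
    using openin_strong_topologyE[OF assms(1,2) g] .
  have "\<exists>f\<in>W. f x = c" if x: "x \<notin> closure B" for x c
  proof -
    obtain \<phi> :: "'a \<Rightarrow> real" and \<delta>
      where \<phi>: "continuous_on UNIV \<phi>" "\<phi> x = 1" "0 < \<delta>" "\<And>y. y \<in> enlargement B \<delta> \<Longrightarrow> \<phi> y = 0"
      using bump_off_closure[OF x] by metis
    \<comment> \<open>The coefficient corrects the value at \<open>x\<close> from \<open>g x\<close>
      to \<open>c\<close>, as the bump is 1 there.\<close>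
    define f where "f y = g y + (c - g x) * \<phi> y" for y
    have "f \<in> cont_funs"
      using \<open>g \<in> cont_funs\<close> \<phi>(1) unfolding f_def cont_funs_def
      by (auto intro!: continuous_intros)
    moreover have "\<forall>y\<in>enlargement B \<delta>. \<bar>g y - f y\<bar> < \<epsilon>"
      unfolding f_def using \<phi>(4) B(2) by simp
    ultimately have "f \<in> strong_entourage B \<epsilon> `` {g}"
      using \<open>g \<in> cont_funs\<close> \<phi>(3) unfolding strong_entourage_def by blast
    moreover have "f x = c"
      unfolding f_def using \<phi>(2) by simp
    ultimately show ?thesis using B(3) by blast
  qed
  then show ?thesis using that B(1) by blast
qed

text \<open>A predetermined strategy reveals the whole sequence \<open>W\<close> in advance. Hence
  one compact \<open>K\<close> can be chosen to escape the controlling sets of all rounds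
  simultaneously.\<close>

lemma plays_with_prescribed_values:
  fixes \<BB> :: "'a::metric_space set set" and W :: "nat \<Rightarrow> ('a \<Rightarrow> real) set"
  assumes "bornology \<BB>" "has_compact_base \<BB>" "\<not> has_countable_base \<BB>"
    and "\<And>n. openin (strong_topology \<BB>) (W n)" "\<And>n. W n \<noteq> {}"
  obtains K x f where "K \<in> \<BB>" "compact K" "\<And>n. x n \<in> K" "\<And>n. f n \<in> W n" "\<And>n. f n (x n) = c n"
proof -
  have "\<forall>n. \<exists>B\<in>\<BB>. \<forall>x c. x \<notin> closure B \<longrightarrow> (\<exists>f\<in>W n. f x = c)"
    using open_set_attains_value_off_closure[OF assms(1,4,5)] by metis
  then obtain B where B: "\<And>n. B n \<in> \<BB>"
      "\<And>n x c. x \<notin> closure (B n) \<Longrightarrow> \<exists>f\<in>W n. f x = c"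
    by metis
  obtain K x where K: "K \<in> \<BB>" "compact K" "\<And>n. x n \<in> K" "\<And>n. x n \<notin> closure (B n)"
    using points_escaping_sequence[of \<BB> B, OF assms(1-3) B(1)] by blast
  have "\<forall>n. \<exists>f. f \<in> W n \<and> f (x n) = c n"
    using B(2)[OF K(4)] by blast
  then show ?thesis
    using that K(1-3) by metis
qed

section \<open>Closures and closed discrete ranges\<close>

lemma zero_not_in_closure:
  fixes f :: "nat \<Rightarrow> 'a::metric_space \<Rightarrow> real"
  assumes "bornology \<BB>" "K \<in> \<BB>" "\<And>n. x n \<in> K" "\<And>n. f n (x n) = 1"
  shows "(\<lambda>x. 0) \<notin> strong_topology \<BB> closure_of range f"
proof
  assume "(\<lambda>x. 0) \<in> strong_topology \<BB> closure_of range f"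
  moreover have "openin (strong_topology \<BB>) (strong_nbhd (\<lambda>x. 0) K 1)"
    using openin_strong_nbhd[OF assms(1,2)] .
  moreover have "(\<lambda>x. 0) \<in> strong_nbhd (\<lambda>x. 0) K 1"
    by (rule strong_nbhd_self) (simp_all add: cont_funs_def)
  ultimately obtain n where "f n \<in> strong_nbhd (\<lambda>x. 0) K 1"
    unfolding in_closure_of by blast
  then have "\<bar>f n (x n) - 0\<bar> < 1"
    using assms(3) by (rule strong_nbhd_less)
  then show False
    using assms(4) by simp
qed

lemma limitin_imp_in_closure_of:
  assumes "limitin T f l sequentially" "\<And>n. f n \<in> topspace T"
  shows "l \<in> T closure_of range f"
  using assms unfolding limitin_def in_closure_of eventually_sequentially by blast

text \<open>Local finiteness passes to subsets, and in a T1 space it makes every subset of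
  \<open>S\<close> closed. With all its subsets closed, \<open>S\<close> is discrete.\<close>

lemma closed_discrete_if_locally_finite:
  assumes "t1_space T" "S \<subseteq> topspace T"
    and "\<And>g. g \<in> topspace T \<Longrightarrow> \<exists>V. openin T V \<and> g \<in> V \<and> finite (V \<inter> S)"
  shows "closed_discrete_in T S"
proof -
  have closed: "closedin T A" if "A \<subseteq> S" for A
  proof -
    have "T closure_of A \<subseteq> A"
    proof
      fix g assume g: "g \<in> T closure_of A"
      then obtain V where V: "openin T V" "g \<in> V" "finite (V \<inter> S)"
        using assms(3) by (meson in_closure_of)
      have "finite (V \<inter> A)"
        using V(3) that by (meson Int_mono finite_subset order_refl)
      then have "closedin T (V \<inter> A)"
        using assms(1,2) that unfolding t1_space_closedin_finite by blast
      \<comment> \<open>Closure is local: neighbourhoods of \<open>g\<close> may be shrunk into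
        \<open>V\<close>, so \<open>g\<close> already lies in the closure of the finite, hence
        closed, set \<open>V \<inter> A\<close>.\<close>
      moreover have "g \<in> T closure_of (V \<inter> A)"
        using g V(1,2) unfolding in_closure_of by (metis Int_iff openin_Int)
      ultimately show "g \<in> A"
        by (metis Int_iff closure_of_eq)
    qed
    then show ?thesis
      using assms(2) that by (metis closure_of_subset_eq order_trans)
  qed
  have "subtopology T S = discrete_topology S"
  proof (rule topology_eq[THEN iffD2], intro allI iffI)
    fix U assume "openin (subtopology T S) U"
    then show "openin (discrete_topology S) U"
      using openin_subset assms(2) by fastforce
  next
    fix U assume "openin (discrete_topology S) U"
    then have "U \<subseteq> S" by simp
    then have "U = (topspace T - (S - U)) \<inter> S"
      using assms(2) by blast
    moreover have "openin T (topspace T - (S - U))"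
      using closed by (simp add: openin_diff)
    ultimately show "openin (subtopology T S) U"
      unfolding openin_subtopology by blast
  qed
  then show ?thesis
    using closed unfolding closed_discrete_in_def by blast
qed

lemma closed_discrete_if_unbounded:
  fixes f :: "nat \<Rightarrow> 'a::metric_space \<Rightarrow> real"
  assumes "bornology \<BB>" "K \<in> \<BB>" "compact K" "\<And>n. x n \<in> K" "\<And>n. f n (x n) = real n"
    and "\<And>n. f n \<in> cont_funs"
  shows "closed_discrete_in (strong_topology \<BB>) (range f)"
proof (rule closed_discrete_if_locally_finite)
  show "t1_space (strong_topology \<BB>)"
    using t1_space_strong_topology[OF assms(1)] .
  show "range f \<subseteq> topspace (strong_topology \<BB>)"
    using assms(6) topspace_strong_topology[OF assms(1)] by blast
  fix g assume "g \<in> topspace (strong_topology \<BB>)"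
  then have g: "g \<in> cont_funs"
    using topspace_strong_topology[OF assms(1)] by blast
  let ?V = "strong_nbhd g K 1"
  have "compact (g ` K)"
    using g assms(3) unfolding cont_funs_def
    by (blast intro: compact_continuous_image continuous_on_subset)
  then have "\<exists>M. \<forall>z\<in>g ` K. \<bar>z\<bar> \<le> M"
    using compact_imp_bounded[of "g ` K"] unfolding bounded_iff real_norm_def by simp
  then obtain M where M: "\<And>y. y \<in> K \<Longrightarrow> \<bar>g y\<bar> \<le> M"
    unfolding ball_simps(9) by metis
  \<comment> \<open>A member \<open>f n\<close> of the neighbourhood has the value \<open>n\<close>
    at a point of \<open>K\<close>, within 1 of a value of \<open>g\<close> bounded by
    \<open>M\<close>. So few indices remain, and with them few functions.\<close>
  have "n \<le> nat \<lceil>M + 1\<rceil>" if "f n \<in> ?V" for n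
  proof -
    have "\<bar>real n - g (x n)\<bar> < 1"
      using strong_nbhd_less[OF that assms(4)] assms(5) by metis
    then have "real n \<le> M + 1"
      using M[OF assms(4), of n] by linarith
    then show ?thesis by linarith
  qed
  then have "?V \<inter> range f \<subseteq> f ` {..nat \<lceil>M + 1\<rceil>}" by blast
  then have "finite (?V \<inter> range f)"
    by (rule finite_subset) simp
  then show "\<exists>V. openin (strong_topology \<BB>) V \<and> g \<in> V \<and> finite (V \<inter> range f)"
    by (intro exI[of _ ?V] conjI openin_strong_nbhd[OF assms(1,2)] strong_nbhd_self[OF g] zero_less_one)
qed

section \<open>Strategies from a countable base\<close>

lemma shrinking_nbhds_converge:
  assumes "bornology \<BB>" "incseq C" "\<And>B. B \<in> \<BB> \<Longrightarrow> \<exists>n. B \<subseteq> C n"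
    and "\<And>n. f n \<in> strong_nbhd l (C n) (1 / real (Suc n))" "l \<in> cont_funs"
  shows "limitin (strong_topology \<BB>) f l sequentially"
  unfolding limitin_def topspace_strong_topology[OF assms(1)]
proof (intro conjI allI impI)
  fix U assume U: "openin (strong_topology \<BB>) U \<and> l \<in> U"
  then obtain B \<epsilon> where B: "B \<in> \<BB>" "0 < \<epsilon>" "strong_entourage B \<epsilon> `` {l} \<subseteq> U"
    using openin_strong_topologyE[OF assms(1)] by blast
  \<comment> \<open>The index \<open>m\<close> takes care of the set \<open>B\<close> and
    \<open>k\<close> of the radius; from \<open>max m k\<close> on, both conditions persist by
    monotonicity.\<close>
  obtain m where m: "B \<subseteq> C m" using assms(3) B(1) by blast
  obtain k where k: "1 / real (Suc k) < \<epsilon>"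
    using B(2) by (metis inverse_eq_divide reals_Archimedean)
  have "f n \<in> U" if "max m k \<le> n" for n
  proof -
    have "B \<subseteq> C n"
      using m assms(2) that unfolding incseq_def by (meson max.boundedE order_trans)
    moreover have "1 / real (Suc n) \<le> 1 / real (Suc k)"
      using that by (intro divide_left_mono) auto
    ultimately have "strong_nbhd l (C n) (1 / real (Suc n)) \<subseteq> strong_entourage B \<epsilon> `` {l}"
      using k by (intro strong_nbhd_subset_entourage assms(5)) auto
    then show ?thesis using assms(4) B(3) by blast
  qed
  then show "\<forall>\<^sub>F n in sequentially. f n \<in> U"
    unfolding eventually_sequentially by blast
qed (rule assms(5))

text \<open>The whole space is not in the bornology, so the closure of \<open>B\<close> omits a
  point, and a bump there is a nonzero member. This keeps ONE's move legal in \<open>CD_game\<close>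
  after the zero function is deleted.\<close>

lemma strong_nbhd_nontrivial:
  fixes \<BB> :: "'a::metric_space set set"
  assumes "bornology \<BB>" "has_compact_base \<BB>" "UNIV \<notin> \<BB>" "B \<in> \<BB>" "0 < \<epsilon>"
  shows "strong_nbhd (\<lambda>x. 0) B \<epsilon> - {\<lambda>x. 0} \<noteq> {}"
proof -
  have "closure B \<noteq> UNIV"
    using closure_in_bornology[OF assms(1,2,4)] assms(3) by metis
  then obtain x where "x \<notin> closure B" by blast
  then obtain \<phi> :: "'a \<Rightarrow> real" and \<delta>
    where \<phi>: "continuous_on UNIV \<phi>" "\<phi> x = 1" "0 < \<delta>" "\<And>y. y \<in> enlargement B \<delta> \<Longrightarrow> \<phi> y = 0"
    using bump_off_closure by metis
  have "\<forall>y\<in>enlargement B \<delta>. \<bar>\<phi> y - 0\<bar> < \<epsilon> / 2"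
    using \<phi>(4) assms(5) by simp
  then have "\<phi> \<in> strong_nbhd (\<lambda>x. 0) B \<epsilon>"
    unfolding strong_nbhd_def cont_funs_def mem_Collect_eq
    using \<phi>(1,3) assms(5) by (intro conjI exI[of _ "\<epsilon> / 2"] exI[of _ \<delta>]) auto
  moreover have "\<phi> \<noteq> (\<lambda>x. 0)"
    using \<phi>(2) by auto
  ultimately show ?thesis by blast
qed

lemma countable_base_imp_strategies:
  fixes \<BB> :: "'a::metric_space set set"
  assumes \<BB>: "bornology \<BB>" "has_compact_base \<BB>" "UNIV \<notin> \<BB>" and "has_countable_base \<BB>"
  shows "ONE_has_predetermined_winning_strategy (Gruenhage_game \<BB>)"
    and "ONE_has_predetermined_winning_strategy (CL_game \<BB>)"
    and "ONE_has_predetermined_winning_strategy (CD_game \<BB>)"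
    and "ONE_has_predetermined_winning_strategy (open_cover_game \<BB>)"
proof -
  obtain C :: "nat \<Rightarrow> 'a set"
    where C: "\<And>n. C n \<in> \<BB>" "incseq C" "\<And>B. B \<in> \<BB> \<Longrightarrow> \<exists>n. B \<subseteq> C n"
    using countable_base_increasing[OF \<BB>(1) assms(4)] by blast
  let ?T = "strong_topology \<BB>"
  define W where "W n = strong_nbhd (\<lambda>x. 0) (C n) (1 / real (Suc n))" for n
  have zero: "(\<lambda>x::'a. 0 :: real) \<in> cont_funs"
    by (simp add: cont_funs_def)
  have W_open: "openin ?T (W n)" for n
    unfolding W_def by (rule openin_strong_nbhd[OF \<BB>(1) C(1)])
  have zero_W: "(\<lambda>x. 0) \<in> W n" for n
    unfolding W_def by (rule strong_nbhd_self[OF zero]) simp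
  have lim: "limitin ?T f (\<lambda>x. 0) sequentially" if "\<forall>n. f n \<in> W n" for f
    using shrinking_nbhds_converge[OF \<BB>(1) C(2,3) _ zero] that unfolding W_def by blast
  have cl: "(\<lambda>x. 0) \<in> ?T closure_of range f" if "\<forall>n. f n \<in> W n" for f
    by (rule limitin_imp_in_closure_of[OF lim[OF that]])
      (use that W_open openin_subset in blast)
  show "ONE_has_predetermined_winning_strategy (Gruenhage_game \<BB>)"
    unfolding ONE_has_predetermined_winning_strategy_def predetermined_winning_def Gruenhage_game_def
    using W_open zero_W lim by (intro exI[of _ W]) simp
  show "ONE_has_predetermined_winning_strategy (CL_game \<BB>)"
    unfolding ONE_has_predetermined_winning_strategy_def predetermined_winning_def CL_game_def
    using W_open zero_W cl by (intro exI[of _ W]) auto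
  define V where "V n = W n - {\<lambda>x. 0}" for n
  have "closedin ?T {\<lambda>x. 0}"
    using t1_space_strong_topology[OF \<BB>(1)] zero topspace_strong_topology[OF \<BB>(1)]
    unfolding t1_space_closedin_singleton by blast
  then have "openin ?T (V n)" for n
    unfolding V_def using W_open by (rule openin_diff[rotated])
  moreover have "V n \<noteq> {}" for n
    unfolding V_def W_def by (rule strong_nbhd_nontrivial[OF \<BB> C(1)]) simp
  moreover have "\<not> closed_discrete_in ?T (range f)" if f: "\<forall>n. f n \<in> V n" for f
  proof
    assume "closed_discrete_in ?T (range f)"
    \<comment> \<open>Closedness is what fails: the zero function is a limit of the moves, but it
      was deleted from every \<open>V n\<close>.\<close>
    then have "?T closure_of range f = range f"
      unfolding closed_discrete_in_def by (simp add: closure_of_eq)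
    moreover have "\<forall>n. f n \<in> W n" "(\<lambda>x. 0) \<notin> range f"
      using f unfolding V_def by (auto simp: image_iff)
    ultimately show False using cl by metis
  qed
  ultimately show "ONE_has_predetermined_winning_strategy (CD_game \<BB>)"
    unfolding ONE_has_predetermined_winning_strategy_def predetermined_winning_def CD_game_def
    by (intro exI[of _ V]) simp
  have "open_strong_cover \<BB> (range U)"
    if U: "\<forall>n. open (U n) \<and> U n \<noteq> UNIV \<and> (\<exists>\<delta>>0. enlargement (C n) \<delta> \<subseteq> U n)" for U
  proof -
    have large: "\<exists>n. \<exists>\<delta>>0. enlargement B \<delta> \<subseteq> U n" if B: "B \<in> \<BB>" for B
    proof -
      obtain n where "B \<subseteq> C n" using C(3) B by blast
      then show ?thesis
        using U enlargement_mono[OF _ order_refl] by (meson order_trans)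
    qed
    \<comment> \<open>Covering the space is the case of singletons in \<open>large\<close>.\<close>
    have "y \<in> \<Union> (range U)" for y
      using large[OF bornology_singleton[OF \<BB>(1), of y]] subset_enlargement[of _ "{y}"] by blast
    then have "\<Union> (range U) = UNIV" by blast
    moreover have "UNIV \<notin> range U" using U by (metis rangeE)
    moreover have "\<forall>B\<in>\<BB>. \<exists>V\<in>range U. \<exists>\<delta>>0. enlargement B \<delta> \<subseteq> V"
      using large by (meson rangeI)
    ultimately show ?thesis
      unfolding open_strong_cover_def using U by simp
  qed
  then show "ONE_has_predetermined_winning_strategy (open_cover_game \<BB>)"
    unfolding ONE_has_predetermined_winning_strategy_def predetermined_winning_def open_cover_game_def
    using C(1) by (intro exI[of _ C]) simp
qed

section \<open>Countable bases from strategies\<close>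

lemma CL_strategy_imp_countable_base:
  fixes \<BB> :: "'a::metric_space set set"
  assumes \<BB>: "bornology \<BB>" "has_compact_base \<BB>"
    and "ONE_has_predetermined_winning_strategy (CL_game \<BB>)"
  shows "has_countable_base \<BB>"
proof (rule ccontr)
  assume no_base: "\<not> has_countable_base \<BB>"
  obtain W :: "nat \<Rightarrow> ('a \<Rightarrow> real) set"
    where W: "\<And>n. openin (strong_topology \<BB>) (W n)" "\<And>n. W n \<noteq> {}"
    and win: "\<And>f. (\<And>n. f n \<in> W n) \<Longrightarrow> (\<lambda>x. 0) \<in> strong_topology \<BB> closure_of range f"
    using assms(3)
    unfolding ONE_has_predetermined_winning_strategy_def predetermined_winning_def CL_game_def
    by auto
  obtain K x f where "K \<in> \<BB>" "\<And>n. x n \<in> K" "\<And>n. f n \<in> W n" "\<And>n. f n (x n) = 1"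
    by (rule plays_with_prescribed_values[of \<BB> W, OF \<BB> no_base W, where c = "\<lambda>n. 1"]) blast
  then show False
    using zero_not_in_closure[OF \<BB>(1)] win by blast
qed

text \<open>The same strategy serves both games, since the limit of a sequence lies in the closure
  of its range. The Gruenhage game thereby inherits the countable base from
  \<open>CL_game\<close>.\<close>

lemma Gruenhage_strategy_imp_CL_strategy:
  assumes "ONE_has_predetermined_winning_strategy (Gruenhage_game \<BB>)"
  shows "ONE_has_predetermined_winning_strategy (CL_game \<BB>)"
proof -
  obtain W where W: "\<And>n. openin (strong_topology \<BB>) (W n)" "\<And>n. (\<lambda>x. 0) \<in> W n"
    and win: "\<And>f. (\<And>n. f n \<in> W n) \<Longrightarrow> limitin (strong_topology \<BB>) f (\<lambda>x. 0) sequentially"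
    using assms
    unfolding ONE_has_predetermined_winning_strategy_def predetermined_winning_def Gruenhage_game_def
    by auto
  have "(\<lambda>x. 0) \<in> strong_topology \<BB> closure_of range f" if f: "\<forall>n. f n \<in> W n" for f
    using limitin_imp_in_closure_of[OF win] f openin_subset[OF W(1)] by blast
  then show ?thesis
    unfolding ONE_has_predetermined_winning_strategy_def predetermined_winning_def CL_game_def
    using W by (intro exI[of _ W]) auto
qed

lemma CD_strategy_imp_countable_base:
  fixes \<BB> :: "'a::metric_space set set"
  assumes \<BB>: "bornology \<BB>" "has_compact_base \<BB>"
    and "ONE_has_predetermined_winning_strategy (CD_game \<BB>)"
  shows "has_countable_base \<BB>"
proof (rule ccontr)
  assume no_base: "\<not> has_countable_base \<BB>"
  obtain W :: "nat \<Rightarrow> ('a \<Rightarrow> real) set"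
    where W: "\<And>n. openin (strong_topology \<BB>) (W n)" "\<And>n. W n \<noteq> {}"
    and win: "\<And>f. (\<And>n. f n \<in> W n) \<Longrightarrow> \<not> closed_discrete_in (strong_topology \<BB>) (range f)"
    using assms(3)
    unfolding ONE_has_predetermined_winning_strategy_def predetermined_winning_def CD_game_def
    by auto
  obtain K x f where f: "K \<in> \<BB>" "compact K" "\<And>n. x n \<in> K" "\<And>n. f n \<in> W n" "\<And>n. f n (x n) = real n"
    by (rule plays_with_prescribed_values[of \<BB> W, OF \<BB> no_base W, where c = real]) blast
  have "f n \<in> cont_funs" for n
    using f(4) openin_subset[OF W(1)] topspace_strong_topology[OF \<BB>(1)] by blast
  then have "closed_discrete_in (strong_topology \<BB>) (range f)"
    by (intro closed_discrete_if_unbounded[of \<BB> K x f] \<BB>(1) f(1-3,5))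
  then show False
    using win f(4) by blast
qed

lemma open_cover_strategy_imp_countable_base:
  fixes \<BB> :: "'a::metric_space set set"
  assumes \<BB>: "bornology \<BB>" "has_compact_base \<BB>"
    and "ONE_has_predetermined_winning_strategy (open_cover_game \<BB>)"
  shows "has_countable_base \<BB>"
proof (rule ccontr)
  assume no_base: "\<not> has_countable_base \<BB>"
  obtain B :: "nat \<Rightarrow> 'a set"
    where B: "\<And>n. B n \<in> \<BB>"
    and win: "\<And>U. (\<And>n. open (U n) \<and> U n \<noteq> UNIV \<and> (\<exists>\<delta>>0. enlargement (B n) \<delta> \<subseteq> U n)) \<Longrightarrow>
      open_strong_cover \<BB> (range U)"
    using assms(3)
    unfolding ONE_has_predetermined_winning_strategy_def predetermined_winning_def open_cover_game_def
    by auto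
  obtain K x where K: "K \<in> \<BB>" "\<And>n. x n \<in> K" "\<And>n. x n \<notin> closure (B n)"
    by (rule points_escaping_sequence[of \<BB> B, OF \<BB> no_base B]) blast
  have "open_strong_cover \<BB> (range (\<lambda>n. - {x n}))"
  proof (rule win)
    fix n
    \<comment> \<open>The bump supplies the radius: it vanishes on the enlargement but is 1 at
      \<open>x n\<close>, so the enlargement avoids \<open>x n\<close>.\<close>
    obtain \<phi> :: "'a \<Rightarrow> real" and \<delta>
      where "\<phi> (x n) = 1" "0 < \<delta>" "\<And>y. y \<in> enlargement (B n) \<delta> \<Longrightarrow> \<phi> y = 0"
      using bump_off_closure[OF K(3)] by metis
    then have "0 < \<delta>" "enlargement (B n) \<delta> \<subseteq> - {x n}"
      by force+
    then show "open (- {x n}) \<and> - {x n} \<noteq> UNIV \<and> (\<exists>\<delta>>0. enlargement (B n) \<delta> \<subseteq> - {x n})"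
      by auto
  qed
  \<comment> \<open>The cover fails at \<open>K\<close> itself, which contains every omitted point
    \<open>x n\<close>.\<close>
  then obtain n \<delta> where "0 < \<delta>" "enlargement K \<delta> \<subseteq> - {x n}"
    using K(1) unfolding open_strong_cover_def by blast
  then show False
    using K(2) subset_enlargement by blast
qed

theorem theorem5p10:
  fixes \<BB> :: "'a::metric_space set set"
  assumes "infinite (UNIV :: 'a set)"
    and "bornology \<BB>"
    and "has_compact_base \<BB>"
    and "UNIV \<notin> \<BB>"
  shows "(has_countable_base \<BB> \<longleftrightarrow>
            ONE_has_predetermined_winning_strategy (Gruenhage_game \<BB>)) \<and>
         (has_countable_base \<BB> \<longleftrightarrow>
            ONE_has_predetermined_winning_strategy (CL_game \<BB>)) \<and>
         (has_countable_base \<BB> \<longleftrightarrow>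
            ONE_has_predetermined_winning_strategy (CD_game \<BB>)) \<and>
         (has_countable_base \<BB> \<longleftrightarrow>
            ONE_has_predetermined_winning_strategy (open_cover_game \<BB>))"
  using countable_base_imp_strategies[OF assms(2-4)]
    Gruenhage_strategy_imp_CL_strategy[of \<BB>]
    CL_strategy_imp_countable_base[OF assms(2,3)]
    CD_strategy_imp_countable_base[OF assms(2,3)]
    open_cover_strategy_imp_countable_base[OF assms(2,3)]
  by blast

end
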